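(* Let $K$ be a knot in $S^{3}$ with a fixed orientation of its normal bundle, let $N_K$ be a regular neighborhood of $K$, and let $Q(K)$ be the fundamental quandle of $K$. Let $f\colon (S^{3},K)\to (S^{3},K)$ be a homeomorphism for which $[f|_{\partial N_{K}}]=\pm 1\in MCG(T^{2})$, i.e. the restriction of $f$ to the torus $\partial N_K\cong T^2$ is isotopic to plus or minus the identity. Then $f$ induces a map $f_{*}\colon Q(K)\to Q(K)$, $f_*([a])=[f\circ a]$, that is either a quandle automorphism or a quandle antiautomorphism.
   Context: A quandle is a nonempty set $Q$ with two binary operations $\rhd,\lhd$ satisfying: (1) $x\rhd x=x$; (2) $(x\rhd y)\lhd y=x=(x\lhd y)\rhd y$; (3) $(x\rhd y)\rhd z=(x\rhd z)\rhd(y\rhd z)$. A map $g\colon Q_1\to Q_2$ of quandles is a homomorphism if $g(x\rhd y)=g(x)\rhd g(y)$ for all $x,y$, and an antihomomorphism if $g(x\rhd y)=g(x)\lhd g(y)$ for all $x,y$. An automorphism (antiautomorphism) of $Q$ is a bijective homomorphism (antihomomorphism) $Q\to Q$. Fundamental quandle: let $K$ be a knot in $S^3$ with a fixed orientation of its normal bundle, $N_K$ a regular neighborhood of $K$, $E_K=S^3-\mathrm{Int}(N_K)$, and $z_K\in E_K$ a basepoint. The underlying set $\Gamma_K$ of $Q(K)$ is the set of homotopy classes of paths in $E_K$ from a point of $\partial N_K$ to $z_K$; during a homotopy the initial point may move on $\partial N_K$ while the final point is kept fixed. For $p\in\partial N_K$, $m_p$ denotes the loop based at $p$ that goes once around the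 meridian circle through $p$ in the positive direction (determined by the orientation of the normal bundle). With $\cdot$ denoting concatenation of paths and $\overline{b}$ the reverse of $b$, the operations are $[a]\rhd[b]=[a\cdot\overline{b}\cdot m_{b(0)}\cdot b]$ and $[a]\lhd[b]=[a\cdot\overline{b}\cdot\overline{m}_{b(0)}\cdot b]$. Conventions for induced maps: $f$ is taken to satisfy $f(N_K)=N_K$ (hence $f(E_K)=E_K$, $f(\partial N_K)=\partial N_K$) and $f(z_K)=z_K$. Minus the identity on $T^2=\mathbb{R}^2/\mathbb{Z}^2$ is the map $x\mapsto -x$. *)

theory Defs
  imports "HOL-Analysis.Analysis"
begin

section \<open>Quandles\<close>

record 'a quandle_struct =
  qcarrier :: "'a set"
  rhd :: "'a \<Rightarrow> 'a \<Rightarrow> 'a"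
  lhd :: "'a \<Rightarrow> 'a \<Rightarrow> 'a"

definition quandle :: "'a quandle_struct \<Rightarrow> bool" where
  "quandle Q \<longleftrightarrow>
     qcarrier Q \<noteq> {} \<and>
     (\<forall>x\<in>qcarrier Q. \<forall>y\<in>qcarrier Q. rhd Q x y \<in> qcarrier Q \<and> lhd Q x y \<in> qcarrier Q) \<and>
     (\<forall>x\<in>qcarrier Q. rhd Q x x = x) \<and>
     (\<forall>x\<in>qcarrier Q. \<forall>y\<in>qcarrier Q.
        lhd Q (rhd Q x y) y = x \<and> rhd Q (lhd Q x y) y = x) \<and>
     (\<forall>x\<in>qcarrier Q. \<forall>y\<in>qcarrier Q. \<forall>z\<in>qcarrier Q.
        rhd Q (rhd Q x y) z = rhd Q (rhd Q x z) (rhd Q y z))"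

definition quandle_hom :: "'a quandle_struct \<Rightarrow> 'b quandle_struct \<Rightarrow> ('a \<Rightarrow> 'b) \<Rightarrow> bool" where
  "quandle_hom Q1 Q2 g \<longleftrightarrow>
     quandle Q1 \<and> quandle Q2 \<and> g \<in> qcarrier Q1 \<rightarrow> qcarrier Q2 \<and>
     (\<forall>x\<in>qcarrier Q1. \<forall>y\<in>qcarrier Q1. g (rhd Q1 x y) = rhd Q2 (g x) (g y))"

definition quandle_antihom :: "'a quandle_struct \<Rightarrow> 'b quandle_struct \<Rightarrow> ('a \<Rightarrow> 'b) \<Rightarrow> bool" where
  "quandle_antihom Q1 Q2 g \<longleftrightarrow>
     quandle Q1 \<and> quandle Q2 \<and> g \<in> qcarrier Q1 \<rightarrow> qcarrier Q2 \<and>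
     (\<forall>x\<in>qcarrier Q1. \<forall>y\<in>qcarrier Q1. g (rhd Q1 x y) = lhd Q2 (g x) (g y))"

definition quandle_automorphism :: "'a quandle_struct \<Rightarrow> ('a \<Rightarrow> 'a) \<Rightarrow> bool" where
  "quandle_automorphism Q g \<longleftrightarrow> quandle_hom Q Q g \<and> bij_betw g (qcarrier Q) (qcarrier Q)"

definition quandle_antiautomorphism :: "'a quandle_struct \<Rightarrow> ('a \<Rightarrow> 'a) \<Rightarrow> bool" where
  "quandle_antiautomorphism Q g \<longleftrightarrow> quandle_antihom Q Q g \<and> bij_betw g (qcarrier Q) (qcarrier Q)"


section \<open>Knots, regular neighborhoods, exteriors\<close>

abbreviation S1 :: "complex set" where
  "S1 \<equiv> sphere 0 1"

abbreviation S3 :: "(real^4) set" where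
  "S3 \<equiv> sphere 0 1"

definition knot :: "(real^4) set \<Rightarrow> bool" where
  "knot K \<longleftrightarrow> K \<subseteq> S3 \<and> K homeomorphic S1"

text \<open>
  A regular neighborhood of \<open>K\<close> is a closed tubular neighborhood. It is presented by an
  open embedding \<open>\<nu>\<close> of the trivial plane bundle over the circle into \<open>S3\<close> that carries the zero
  section onto \<open>K\<close>; \<open>N\<close> is the image of the unit disc bundle. Wild knots admit no such \<open>\<nu>\<close>.
  That \<open>\<nu>\<close> extends beyond the unit disc bundle makes the boundary torus of \<open>N\<close> collared from
  outside as well.
\<close>

definition regular_neighborhood ::
    "(real^4) set \<Rightarrow> (complex \<times> complex \<Rightarrow> real^4) \<Rightarrow> (real^4) set \<Rightarrow> bool" where
  "regular_neighborhood K \<nu> N \<longleftrightarrow>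
     embedding_map (top_of_set (S1 \<times> UNIV)) (top_of_set S3) \<nu> \<and>
     open_map (top_of_set (S1 \<times> UNIV)) (top_of_set S3) \<nu> \<and>
     \<nu> ` (S1 \<times> {0}) = K \<and>
     \<nu> ` (S1 \<times> cball 0 1) = N"

definition exterior :: "(real^4) set \<Rightarrow> (real^4) set" where
  "exterior N = S3 - (top_of_set S3) interior_of N"

definition boundary_torus :: "(real^4) set \<Rightarrow> (real^4) set" where
  "boundary_torus N = (top_of_set S3) frontier_of N"

text \<open>
  An orientation of the normal bundle is a continuous choice of an orientation of each normal
  plane. Relative to \<open>\<nu>\<close> it is a continuous sign on \<open>K\<close>: the value at \<open>x = \<nu> (u, 0)\<close> is \<open>1\<close> if
  \<open>v \<mapsto> \<nu> (u, v)\<close> carries the standard orientation of \<open>\<complex>\<close> to the chosen orientation at \<open>x\<close>,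
  and \<open>-1\<close> otherwise.
\<close>

definition normal_orientation :: "(real^4) set \<Rightarrow> (real^4 \<Rightarrow> real) \<Rightarrow> bool" where
  "normal_orientation K \<epsilon> \<longleftrightarrow> continuous_on K \<epsilon> \<and> \<epsilon> ` K \<subseteq> {1, -1}"

definition meridian ::
    "(complex \<times> complex \<Rightarrow> real^4) \<Rightarrow> (real^4 \<Rightarrow> real) \<Rightarrow> real^4 \<Rightarrow> real \<Rightarrow> real^4" where
  "meridian \<nu> \<epsilon> p =
     (let (u, v) = inv_into (S1 \<times> UNIV) \<nu> p
      in (\<lambda>t. \<nu> (u, cis (2 * pi * \<epsilon> (\<nu> (u, 0)) * t) * v)))"


section \<open>The fundamental quandle\<close>

definition quandle_paths :: "(real^4) set \<Rightarrow> real^4 \<Rightarrow> (real \<Rightarrow> real^4) set" where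
  "quandle_paths N z =
     {a. path a \<and> path_image a \<subseteq> exterior N \<and> pathstart a \<in> boundary_torus N \<and> pathfinish a = z}"

definition quandle_path_rel ::
    "(real^4) set \<Rightarrow> real^4 \<Rightarrow> ((real \<Rightarrow> real^4) \<times> (real \<Rightarrow> real^4)) set" where
  "quandle_path_rel N z =
     {(a, b). a \<in> quandle_paths N z \<and> b \<in> quandle_paths N z \<and>
        homotopic_with_canon (\<lambda>c. pathstart c \<in> boundary_torus N \<and> pathfinish c = z)
          {0..1} (exterior N) a b}"

definition quandle_class ::
    "(real^4) set \<Rightarrow> real^4 \<Rightarrow> (real \<Rightarrow> real^4) \<Rightarrow> (real \<Rightarrow> real^4) set" where
  "quandle_class N z a = quandle_path_rel N z `` {a}"

text \<open>
  The operations on homotopy classes are the unions of the resulting classes over all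
  representatives, as is usual for functions on quotients; if the result depended on the
  representatives, such a union would not be a homotopy class.
\<close>

definition fundamental_quandle ::
    "(real^4) set \<Rightarrow> (complex \<times> complex \<Rightarrow> real^4) \<Rightarrow> (real^4 \<Rightarrow> real) \<Rightarrow> real^4 \<Rightarrow>
     (real \<Rightarrow> real^4) set quandle_struct" where
  "fundamental_quandle N \<nu> \<epsilon> z =
     \<lparr> qcarrier = quandle_paths N z // quandle_path_rel N z,
       rhd = (\<lambda>A B. \<Union>a\<in>A. \<Union>b\<in>B.
         quandle_class N z
           (a +++ reversepath b +++ meridian \<nu> \<epsilon> (pathstart b) +++ b)),
       lhd = (\<lambda>A B. \<Union>a\<in>A. \<Union>b\<in>B.
         quandle_class N z
           (a +++ reversepath b +++ reversepath (meridian \<nu> \<epsilon> (pathstart b)) +++ b)) \<rparr>"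


section \<open>Isotopy of homeomorphisms; the torus\<close>

definition isotopic :: "'a topology \<Rightarrow> ('a \<Rightarrow> 'a) \<Rightarrow> ('a \<Rightarrow> 'a) \<Rightarrow> bool" where
  "isotopic X f g \<longleftrightarrow> homotopic_with (homeomorphic_map X X) X X f g"

text \<open>
  The torus \<open>\<real>\<^sup>2 / \<int>\<^sup>2\<close> is modelled as the product of two unit circles, through
  \<open>(s, t) \<mapsto> (cis (2 * pi * s), cis (2 * pi * t))\<close>. Under this group isomorphism \<open>x \<mapsto> -x\<close>
  becomes complex conjugation in both factors.
\<close>

abbreviation T2 :: "(complex \<times> complex) topology" where
  "T2 \<equiv> top_of_set (S1 \<times> S1)"

definition minus_id_T2 :: "complex \<times> complex \<Rightarrow> complex \<times> complex" where
  "minus_id_T2 = (\<lambda>(u, v). (cnj u, cnj v))"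

end

theory Submission
  imports Defs
begin

text \<open>
  Write \<open>E\<close> for the exterior, \<open>B\<close> for its boundary torus and \<open>m p\<close> for the meridian through \<open>p\<close>.
  A path \<open>b\<close> from \<open>B\<close> to \<open>z\<close> determines the loop \<open>L b = reverse b \<cdot> m (b 0) \<cdot> b\<close> at \<open>z\<close>
  (\<open>conjugate_loop\<close>), and the first operation of the quandle is \<open>[a] \<rhd> [b] = [a \<cdot> L b]\<close>; the
  second one is the same construction for the reversed meridians. What matters about the meridians
  is that they are loops in \<open>B\<close> which vary continuously with their base point (locale
  \<open>boundary_loop_field\<close>).

  Two paths are equivalent exactly if they differ, up to homotopy with fixed ends, by an initial
  path in \<open>B\<close> (\<open>rel_iff\<close>). Transporting the loop \<open>m p\<close> along a path in \<open>B\<close> gives the loop at the other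
  end (\<open>field_transport\<close>), so the class of \<open>L b\<close> in the fundamental group of \<open>E\<close> depends on the class
  of \<open>b\<close> alone. This group acts on the classes of paths, \<open>L\<close> is equivariant for conjugation
  (\<open>conjugate_loop_append\<close>), and \<open>a \<cdot> L a \<simeq> m (a 0) \<cdot> a\<close> is equivalent to \<open>a\<close>; these facts give the
  quandle axioms.

  The homeomorphism \<open>f\<close> maps \<open>L b\<close> to \<open>reverse (f \<circ> b) \<cdot> (f \<circ> m (b 0)) \<cdot> (f \<circ> b)\<close>. So it respects the
  operations as soon as \<open>f \<circ> m p\<close> is homotopic to \<open>m (f p)\<close>, and it exchanges them if
  \<open>f \<circ> m p\<close> is homotopic to the reverse of \<open>m (f p)\<close>. By transport of loops it suffices to know the
  free homotopy class of \<open>f \<circ> m p\<close> in \<open>B\<close> (\<open>field_image_homotopic\<close>). An isotopy from \<open>f\<close> to the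
  identity of the torus makes it the class of \<open>m p\<close>. An isotopy to minus the identity makes it the
  class of the reverse of \<open>m p\<close>, because on a torus the inversion of the group reverses the free
  homotopy class of every loop (\<open>homotopic_loops_torus_inverse\<close>). The same sign serves all \<open>p\<close>, and
  the induced map is bijective because the inverse of \<open>f\<close> induces its inverse.
\<close>

section \<open>Homotopies of paths\<close>

lemma homotopic_paths_cancel_left:
  fixes p r :: "real \<Rightarrow> 'a::real_normed_vector"
  assumes "path p" "path_image p \<subseteq> S" "path r" "path_image r \<subseteq> S" "pathstart r = pathstart p"
  shows "homotopic_paths S (p +++ (reversepath p +++ r)) r"
proof -
  have "homotopic_paths S (p +++ (reversepath p +++ r)) ((p +++ reversepath p) +++ r)"
    using assms by (intro homotopic_paths_assoc) auto
  also have "homotopic_paths S \<dots> (linepath (pathstart p) (pathstart p) +++ r)"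
    using assms by (intro homotopic_paths_join homotopic_paths_rinv) auto
  also have "homotopic_paths S \<dots> r"
    using assms by (intro homotopic_paths_lid') auto
  finally show ?thesis .
qed

lemma homotopic_paths_cancel_left':
  fixes p r :: "real \<Rightarrow> 'a::real_normed_vector"
  assumes "path p" "path_image p \<subseteq> S" "path r" "path_image r \<subseteq> S" "pathstart r = pathfinish p"
  shows "homotopic_paths S (reversepath p +++ (p +++ r)) r"
  using homotopic_paths_cancel_left [of "reversepath p" S r] assms by simp

lemma homotopic_paths_cancel_right:
  fixes p r :: "real \<Rightarrow> 'a::real_normed_vector"
  assumes "path p" "path_image p \<subseteq> S" "path r" "path_image r \<subseteq> S" "pathfinish r = pathstart p"
  shows "homotopic_paths S ((r +++ p) +++ reversepath p) r"
proof -
  have "homotopic_paths S ((r +++ p) +++ reversepath p) (r +++ (p +++ reversepath p))"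
    using assms by (intro homotopic_paths_sym [OF homotopic_paths_assoc]) auto
  also have "homotopic_paths S \<dots> (r +++ linepath (pathstart p) (pathstart p))"
    using assms by (intro homotopic_paths_join homotopic_paths_rinv) auto
  also have "homotopic_paths S \<dots> r"
    using assms by (intro homotopic_paths_rid') auto
  finally show ?thesis .
qed

text \<open>
  The two ways around the unit square are homotopic in the square, because it is convex; the
  homotopy is carried along by \<open>H\<close>. All passages from free homotopies to homotopies with fixed
  ends go through this lemma.
\<close>

lemma homotopic_paths_around_square:
  fixes H :: "real \<times> real \<Rightarrow> 'a::real_normed_vector"
  assumes "continuous_on ({0..1} \<times> {0..1}) H" "H ` ({0..1} \<times> {0..1}) \<subseteq> S"
  shows "homotopic_paths S ((\<lambda>t. H (0, t)) +++ (\<lambda>s. H (s, 1))) ((\<lambda>s. H (s, 0)) +++ (\<lambda>t. H (1, t)))"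
proof -
  let ?I = "{0..1} \<times> {0..1} :: (real \<times> real) set"
  let ?p = "linepath (0, 0) (0, 1) +++ linepath (0, 1) (1, 1) :: real \<Rightarrow> real \<times> real"
  let ?q = "linepath (0, 0) (1, 0) +++ linepath (1, 0) (1, 1) :: real \<Rightarrow> real \<times> real"
  have cv: "convex ?I"
    by (intro convex_Times) auto
  have sub: "path_image ?p \<subseteq> ?I" "path_image ?q \<subseteq> ?I"
    using cv by (intro subset_path_image_join; simp add: path_image_linepath closed_segment_subset)+
  have "homotopic_paths ?I ?p ?q"
  proof (rule homotopic_paths_linear)
    fix t :: real assume "t \<in> {0..1}"
    then have "?p t \<in> ?I" "?q t \<in> ?I"
      using sub unfolding path_image_def by blast+
    then show "closed_segment (?p t) (?q t) \<subseteq> ?I"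
      by (rule closed_segment_subset [OF _ _ cv])
  qed auto
  then have "homotopic_paths S (H \<circ> ?p) (H \<circ> ?q)"
    using assms by (intro homotopic_paths_continuous_image) auto
  moreover have "H \<circ> ?p = (\<lambda>t. H (0, t)) +++ (\<lambda>s. H (s, 1))"
    "H \<circ> ?q = (\<lambda>s. H (s, 0)) +++ (\<lambda>t. H (1, t))"
    unfolding path_compose_join by (simp_all add: linepath_def o_def)
  ultimately show ?thesis by simp
qed

lemma path_in_imp_mem:
  assumes "path_image p \<subseteq> S" "t \<in> {0..1}"
  shows "p t \<in> S"
  using assms unfolding path_image_def by blast

lemma homotopic_paths_cong:
  assumes "homotopic_paths S p q"
    and "\<And>t. t \<in> {0..1} \<Longrightarrow> p t = p' t" "\<And>t. t \<in> {0..1} \<Longrightarrow> q t = q' t"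
  shows "homotopic_paths S p' q'"
proof -
  have "homotopic_paths S p p'" "homotopic_paths S q q'"
    using homotopic_paths_imp_path [OF assms(1)] homotopic_paths_imp_subset [OF assms(1)] assms(2,3)
    by (auto intro: homotopic_paths_eq)
  then show ?thesis
    using assms(1) by (meson homotopic_paths_sym homotopic_paths_trans)
qed

lemma path_compose_in:
  assumes "continuous_on B h" "h ` B \<subseteq> S" "path g" "path_image g \<subseteq> B"
  shows "path (h \<circ> g)" "path_image (h \<circ> g) \<subseteq> S"
proof -
  show "path (h \<circ> g)"
    using assms(3) continuous_on_subset [OF assms(1,4)] by (rule path_continuous_image)
  show "path_image (h \<circ> g) \<subseteq> S"
    using assms(2,4) unfolding path_image_compose by blast
qed

section \<open>Loops on the torus\<close>

text \<open>
  In a commutative topological group, inverting a loop \<open>g\<close> pointwise and reversing it gives freely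
  homotopic loops. The map \<open>(x, y) \<mapsto> g x * inverse (g y)\<close> on the unit square sends the diagonal to
  the neutral element; the straight segments from \<open>(s, s)\<close> to \<open>(0, 1)\<close> therefore give loops, which
  run from \<open>t \<mapsto> g 0 * inverse (g t)\<close> to \<open>t \<mapsto> g (1 - t) * inverse (g 1)\<close>. A path \<open>w\<close> from
  \<open>inverse (g 0)\<close> to \<open>g 0\<close> removes the two constant factors. On the unit circle the inverse is the
  complex conjugate.
\<close>

lemma homotopic_loops_torus_inverse:
  assumes "path g" "path_image g \<subseteq> S1 \<times> S1" "pathfinish g = pathstart g"
  shows "homotopic_loops (S1 \<times> S1) (minus_id_T2 \<circ> g) (reversepath g)"
proof -
  have "path_connected (S1 \<times> S1)"
    by (intro path_connected_Times path_connected_sphere) auto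
  have in01: "g t \<in> S1 \<times> S1" if "t \<in> {0..1}" for t
    using assms(2) that by (rule path_in_imp_mem)
  have g1: "g 1 = g 0"
    using assms(3) by (simp add: pathfinish_def pathstart_def)
  have g0: "g 0 \<in> S1 \<times> S1"
    by (rule in01) auto
  then have "minus_id_T2 (g 0) \<in> S1 \<times> S1"
    by (auto simp: minus_id_T2_def split: prod.splits)
  then obtain w where w: "path w" "path_image w \<subseteq> S1 \<times> S1"
      "pathstart w = minus_id_T2 (g 0)" "pathfinish w = g 0"
    using \<open>path_connected (S1 \<times> S1)\<close> g0 unfolding path_connected_def by metis
  have w0: "w 0 = minus_id_T2 (g 0)" and w1: "w 1 = g 0"
    using w by (auto simp: pathstart_def pathfinish_def)
  have win: "w t \<in> S1 \<times> S1" if "t \<in> {0..1}" for t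
    using w(2) that by (rule path_in_imp_mem)
  \<comment> \<open>\<open>(x, y)\<close> is the point at time \<open>t\<close> of the segment from \<open>(s, s)\<close> to \<open>(0, 1)\<close>.\<close>
  define x where "x = (\<lambda>(s, t). s * (1 - t) :: real)"
  define y where "y = (\<lambda>(s, t). (1 - s) * t + s :: real)"
  define H where "H = (\<lambda>p. (fst (w (fst p)) * fst (g (x p)) * cnj (fst (g (y p))),
                            snd (w (fst p)) * snd (g (x p)) * cnj (snd (g (y p)))))"
  let ?I = "{0..1} \<times> {0..1} :: (real \<times> real) set"
  have xI: "x p \<in> {0..1}" if "p \<in> ?I" for p
    using that by (auto simp: x_def mult_le_one)
  have yI: "y p \<in> {0..1}" if "p \<in> ?I" for p
  proof -
    obtain s t where p: "p = (s, t)" by force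
    have "(1 - s) * t \<le> (1 - s) * 1"
      using that p by (intro mult_left_mono) auto
    then show ?thesis
      using that p by (auto simp: y_def)
  qed
  have cx: "continuous_on ?I x" and cy: "continuous_on ?I y"
    unfolding x_def y_def case_prod_unfold by (intro continuous_intros)+
  have cg: "continuous_on {0..1} g" and cw: "continuous_on {0..1} w"
    using assms(1) w(1) by (auto simp: path_def)
  have cgx: "continuous_on ?I (\<lambda>p. g (x p))"
    by (rule continuous_on_compose2 [OF cg cx]) (use xI in auto)
  have cgy: "continuous_on ?I (\<lambda>p. g (y p))"
    by (rule continuous_on_compose2 [OF cg cy]) (use yI in auto)
  have cws: "continuous_on ?I (\<lambda>p. w (fst p))"
    by (rule continuous_on_compose2 [OF cw continuous_on_fst]) (auto intro: continuous_intros)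
  have unit: "a * cnj a = 1" "cnj a * a = 1" if "norm a = 1" for a :: complex
    using that by (simp_all add: complex_norm_square [symmetric] mult.commute)
  have cancel: "a * b * cnj a = b" if "norm a = 1" for a b :: complex
    using unit(1) [OF that] by (simp add: algebra_simps)
  have hc: "continuous_on ?I H"
    unfolding H_def by (intro continuous_intros cgx cgy cws)
  have hr: "H \<in> ?I \<rightarrow> S1 \<times> S1"
  proof
    fix p assume p: "p \<in> ?I"
    then have "fst p \<in> {0..1}" by auto
    then show "H p \<in> S1 \<times> S1"
      using in01 [OF xI [OF p]] in01 [OF yI [OF p]] win
      by (simp add: H_def norm_mult mem_Times_iff)
  qed
  have h0: "\<forall>t\<in>{0..1}. H (0, t) = (minus_id_T2 \<circ> g) t"
    using g0 unit by (simp add: H_def x_def y_def w0 minus_id_T2_def case_prod_unfold mem_Times_iff)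
  have h1: "\<forall>t\<in>{0..1}. H (1, t) = reversepath g t"
    using g0 cancel by (simp add: H_def x_def y_def w1 g1 reversepath_def mem_Times_iff prod_eq_iff)
  have hl: "\<forall>s\<in>{0..1}. pathfinish (H \<circ> Pair s) = pathstart (H \<circ> Pair s)"
  proof
    fix s :: real assume "s \<in> {0..1}"
    then show "pathfinish (H \<circ> Pair s) = pathstart (H \<circ> Pair s)"
      using in01 [of s] unit g0
      by (simp add: H_def x_def y_def pathfinish_def pathstart_def g1 mem_Times_iff mult.assoc)
  qed
  show ?thesis
    by (rule homotopic_loops [THEN iffD2]) (rule exI [of _ H], intro conjI hc hr h0 h1 hl)
qed

section \<open>The quandle of a field of loops on the boundary torus\<close>

definition conjugate_loop :: "('a \<Rightarrow> real \<Rightarrow> 'a::topological_space) \<Rightarrow> (real \<Rightarrow> 'a) \<Rightarrow> real \<Rightarrow> 'a" where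
  "conjugate_loop m b = reversepath b +++ m (pathstart b) +++ b"

text \<open>
  The common form of \<open>rhd\<close> and \<open>lhd\<close> in the fundamental quandle, with the field of loops as a
  parameter.
\<close>

definition class_operation ::
    "(real^4) set \<Rightarrow> real^4 \<Rightarrow> (real^4 \<Rightarrow> real \<Rightarrow> real^4) \<Rightarrow>
     (real \<Rightarrow> real^4) set \<Rightarrow> (real \<Rightarrow> real^4) set \<Rightarrow> (real \<Rightarrow> real^4) set" where
  "class_operation N z m A C =
     (\<Union>a\<in>A. \<Union>b\<in>C. quandle_class N z (a +++ conjugate_loop m b))"

text \<open>
  The meridians and the reversed meridians are two instances, so each fact proved here serves
  both operations of the quandle. The base point enters through the first assumption, which
  makes the carrier nonempty.
\<close>

locale boundary_loop_field =
  fixes N :: "(real^4) set" and z :: "real^4" and m :: "real^4 \<Rightarrow> real \<Rightarrow> real^4"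
  assumes paths_nonempty: "quandle_paths N z \<noteq> {}"
    and boundary_subset: "boundary_torus N \<subseteq> exterior N"
    and continuous_field: "continuous_on (boundary_torus N \<times> {0..1}) (\<lambda>(p, t). m p t)"
    and field_in: "\<And>p t. p \<in> boundary_torus N \<Longrightarrow> t \<in> {0..1} \<Longrightarrow> m p t \<in> boundary_torus N"
    and field_0 [simp]: "\<And>p. p \<in> boundary_torus N \<Longrightarrow> m p 0 = p"
    and field_1 [simp]: "\<And>p. p \<in> boundary_torus N \<Longrightarrow> m p 1 = p"
begin

abbreviation "E \<equiv> exterior N"
abbreviation "B \<equiv> boundary_torus N"
abbreviation "Q \<equiv> quandle_paths N z"
abbreviation "cl \<equiv> quandle_class N z"

lemma continuous_on_field:
  fixes u :: "'b::topological_space \<Rightarrow> real^4"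
  assumes "continuous_on S u" "continuous_on S v" "u ` S \<subseteq> B" "v ` S \<subseteq> {0..1}"
  shows "continuous_on S (\<lambda>x. m (u x) (v x))"
proof -
  have "continuous_on S (\<lambda>x. (u x, v x))"
    using assms(1,2) by (rule continuous_on_Pair)
  moreover have "(\<lambda>x. (u x, v x)) ` S \<subseteq> B \<times> {0..1}"
    using assms(3,4) by blast
  ultimately have "continuous_on S (\<lambda>x. (\<lambda>(p, t). m p t) (u x, v x))"
    by (rule continuous_on_compose2 [OF continuous_field])
  then show ?thesis by simp
qed

lemma reverse_field: "boundary_loop_field N z (\<lambda>p. reversepath (m p))"
proof
  have "continuous_on (B \<times> {0..1}) (\<lambda>q. m (fst q) (1 - snd q))"
    by (rule continuous_on_field) (auto intro!: continuous_intros)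
  then show "continuous_on (B \<times> {0..1}) (\<lambda>(p, t). reversepath (m p) t)"
    by (simp add: reversepath_def case_prod_unfold)
qed (use paths_nonempty boundary_subset field_in in \<open>auto simp: reversepath_def\<close>)

lemma path_field [simp]: "p \<in> B \<Longrightarrow> path (m p)"
  unfolding path_def using continuous_on_field [of "{0..1}" "\<lambda>_. p" "\<lambda>t. t"] by auto

lemma field_image_boundary:
  "p \<in> B \<Longrightarrow> path_image (m p) \<subseteq> B"
  using field_in by (auto simp: path_image_def)

lemma field_image [simp]:
  "p \<in> B \<Longrightarrow> path_image (m p) \<subseteq> E"
  using field_image_boundary boundary_subset by blast

lemma field_ends [simp]:
  "p \<in> B \<Longrightarrow> pathstart (m p) = p" "p \<in> B \<Longrightarrow> pathfinish (m p) = p"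
  by (auto simp: pathstart_def pathfinish_def)

lemma quandle_pathsD [simp]:
  assumes "a \<in> Q"
  shows "path a" "path_image a \<subseteq> E" "pathstart a \<in> B" "pathfinish a = z"
  using assms unfolding quandle_paths_def by blast+

lemma base_in [simp]: "z \<in> E"
  using paths_nonempty quandle_pathsD pathfinish_in_path_image by blast

declare subset_path_image_join [simp]

lemma quandle_pathsI:
  assumes "path a" "path_image a \<subseteq> E" "pathstart a \<in> B" "pathfinish a = z"
  shows "a \<in> Q"
  using assms unfolding quandle_paths_def by blast

lemma append_loop_in:
  assumes "a \<in> Q" "path l" "path_image l \<subseteq> E" "pathstart l = z" "pathfinish l = z"
  shows "a +++ l \<in> Q"
  using assms by (intro quandle_pathsI subset_path_image_join) auto

lemma homotopic_paths_in:
  assumes "a \<in> Q" "homotopic_paths E a b"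
  shows "b \<in> Q"
  using quandle_pathsD [OF assms(1)] homotopic_paths_imp_path [OF assms(2)]
    homotopic_paths_imp_subset [OF assms(2)] homotopic_paths_imp_pathstart [OF assms(2)]
    homotopic_paths_imp_pathfinish [OF assms(2)]
  by (intro quandle_pathsI) simp_all

lemma equiv_rel: "equiv Q (quandle_path_rel N z)"
proof (rule equivI)
  show "quandle_path_rel N z \<subseteq> Q \<times> Q"
    unfolding quandle_path_rel_def by blast
  show "refl_on Q (quandle_path_rel N z)"
  proof (rule refl_onI)
    fix a assume a: "a \<in> Q"
    then have "continuous_on {0..1} a" "a ` {0..1} \<subseteq> E"
      using quandle_pathsD(1,2) [OF a] by (auto simp: path_def path_image_def)
    then show "(a, a) \<in> quandle_path_rel N z"
      using a by (auto simp: quandle_path_rel_def)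
  qed
  show "sym (quandle_path_rel N z)"
    unfolding quandle_path_rel_def by (rule symI) (simp add: homotopic_with_sym)
  show "trans (quandle_path_rel N z)"
    unfolding quandle_path_rel_def by (rule transI) (use homotopic_with_trans in blast)
qed

lemma homotopic_paths_rel:
  assumes "a \<in> Q" "homotopic_paths E a b"
  shows "(a, b) \<in> quandle_path_rel N z"
proof -
  have "b \<in> Q" using homotopic_paths_in assms .
  moreover have "homotopic_with_canon (\<lambda>c. pathstart c \<in> B \<and> pathfinish c = z) {0..1} E a b"
    using assms(2) unfolding homotopic_paths_def
    by (rule homotopic_with_mono) (use assms(1) in simp)
  ultimately show ?thesis
    using assms by (simp add: quandle_path_rel_def)
qed

text \<open>
  Sliding the initial point along \<open>c\<close>: at time \<open>s\<close> the path starts with the part of \<open>c\<close> that is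
  still to be run.
\<close>

lemma prefix_rel:
  assumes "b \<in> Q" "path c" "path_image c \<subseteq> B" "pathfinish c = pathstart b"
  shows "(c +++ b, b) \<in> quandle_path_rel N z"
proof -
  have cE: "path_image c \<subseteq> E"
    using assms(3) boundary_subset by blast
  have cB: "c t \<in> B" if "t \<in> {0..1}" for t
    using assms(3) that by (rule path_in_imp_mem)
  have cb: "c +++ b \<in> Q"
    using assms cE pathstart_in_path_image [of c]
    by (intro quandle_pathsI subset_path_image_join) auto
  let ?I = "{0..1} \<times> {0..1} :: (real \<times> real) set"
  define k where "k = (\<lambda>s::real. subpath s 1 c +++ b)"
  have arg: "(1 - s) * t + s \<in> {0..1}" if "(s, t) \<in> ?I" for s t :: real
  proof -
    have "(1 - s) * t \<le> (1 - s) * 1"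
      using that by (intro mult_left_mono) auto
    then show ?thesis using that by auto
  qed
  have "continuous_on ?I (\<lambda>y. k (fst y) (snd y))"
    unfolding k_def
  proof (rule continuous_on_homotopic_join_lemma)
    have "continuous_on ?I (\<lambda>y. c ((1 - fst y) * snd y + fst y))"
      by (rule continuous_on_compose2 [OF assms(2) [unfolded path_def]])
         (use arg in \<open>auto intro!: continuous_intros\<close>)
    then show "continuous_on ?I (\<lambda>y. subpath (fst y) 1 c (snd y))"
      by (simp add: subpath_def)
    show "continuous_on ?I (\<lambda>y. b (snd y))"
      by (rule continuous_on_compose2 [of "{0..1}" b])
         (use assms(1) in \<open>auto intro!: continuous_intros simp: path_def [symmetric]\<close>)
    show "pathfinish (subpath s 1 c) = pathstart b" for s
      using assms(4) by (simp add: pathfinish_def [of c])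
  qed
  moreover have "k s t \<in> E" if "s \<in> {0..1}" "t \<in> {0..1}" for s t
  proof -
    have "path_image (subpath s 1 c) \<subseteq> E"
      using path_image_subpath_subset [of s 1 c] that cE by auto
    then have "path_image (k s) \<subseteq> E"
      unfolding k_def using assms(1) by (intro subset_path_image_join) auto
    then show ?thesis using that(2) by (rule path_in_imp_mem)
  qed
  moreover have "k 0 = c +++ b"
    by (simp add: k_def)
  moreover have "pathstart (k s) \<in> B" "pathfinish (k s) = z" if "s \<in> {0..1}" for s
    using that assms(1) cB by (auto simp: k_def)
  ultimately have "homotopic_with_canon (\<lambda>c. pathstart c \<in> B \<and> pathfinish c = z) {0..1} E (c +++ b) (k 1)"
    unfolding homotopic_with_def
    by (intro exI [of _ "\<lambda>y. k (fst y) (snd y)"]) (auto simp: image_subset_iff)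
  moreover have "k 1 \<in> Q"
    using homotopic_with_imp_continuous [OF calculation] homotopic_with_imp_subset2 [OF calculation]
      homotopic_with_imp_property [OF calculation]
    by (intro quandle_pathsI) (auto simp: path_def path_image_def)
  ultimately have "(c +++ b, k 1) \<in> quandle_path_rel N z"
    using cb by (simp add: quandle_path_rel_def)
  moreover have "k 1 = linepath (pathstart b) (pathstart b) +++ b"
    using assms(4) by (simp add: k_def subpath_refl pathfinish_def linepath_refl)
  then have "homotopic_paths E (k 1) b"
    using assms(1) homotopic_paths_lid [of b E] by simp
  ultimately show ?thesis
    using homotopic_paths_rel [OF \<open>k 1 \<in> Q\<close>] equiv_rel
    by (meson equivE transE)
qed

text \<open>
  The moving-endpoint relation, reduced to homotopies with fixed ends: the trace \<open>c\<close> of the initial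
  point is all that the latter miss.
\<close>

lemma rel_iff:
  assumes "a \<in> Q" "b \<in> Q"
  shows "(a, b) \<in> quandle_path_rel N z \<longleftrightarrow>
    (\<exists>c. path c \<and> path_image c \<subseteq> B \<and> pathstart c = pathstart a \<and> pathfinish c = pathstart b \<and>
         homotopic_paths E a (c +++ b))"
proof
  assume "(a, b) \<in> quandle_path_rel N z"
  then have "homotopic_with_canon (\<lambda>c. pathstart c \<in> B \<and> pathfinish c = z) {0..1} E a b"
    by (simp add: quandle_path_rel_def)
  then obtain H :: "real \<times> real \<Rightarrow> real^4" where "continuous_on ({0..1} \<times> {0..1}) H" "H \<in> {0..1} \<times> {0..1} \<rightarrow> E"
      "\<forall>x. H (0, x) = a x" "\<forall>x. H (1, x) = b x" "\<forall>t\<in>{0..1}. H (t, 0) \<in> B \<and> H (t, 1) = z"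
    unfolding homotopic_with_def by (auto simp: pathstart_def pathfinish_def)
  then have H: "continuous_on ({0..1} \<times> {0..1}) H" "H ` ({0..1} \<times> {0..1}) \<subseteq> E"
      "\<And>x. H (0, x) = a x" "\<And>x. H (1, x) = b x"
      "\<And>t. t \<in> {0..1} \<Longrightarrow> H (t, 0) \<in> B \<and> H (t, 1) = z"
    by blast+
  define c where "c = (\<lambda>s. H (s, 0))"
  have c: "path c" "path_image c \<subseteq> B" "pathstart c = pathstart a" "pathfinish c = pathstart b"
    unfolding c_def path_def path_image_def pathstart_def pathfinish_def
    using H by (auto intro!: continuous_on_compose2 [OF H(1)] continuous_intros)
  have "homotopic_paths E (a +++ (\<lambda>s. H (s, 1))) (c +++ b)"
    using homotopic_paths_around_square [OF H(1,2)] H(3,4) by (simp add: c_def)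
  moreover have "homotopic_paths E (a +++ (\<lambda>s. H (s, 1))) (a +++ linepath z z)"
  proof (rule homotopic_paths_join)
    show "homotopic_paths E a a"
      using assms by simp
    have "homotopic_paths E (linepath z z) (\<lambda>s. H (s, 1))"
      using H(5) by (intro homotopic_paths_eq) simp_all
    then show "homotopic_paths E (\<lambda>s. H (s, 1)) (linepath z z)"
      by (rule homotopic_paths_sym)
    show "pathfinish a = pathstart (\<lambda>s. H (s, 1))"
      using H(5) [of 0] assms by (simp add: pathstart_def)
  qed
  moreover have "homotopic_paths E (a +++ linepath z z) a"
    using assms by (intro homotopic_paths_rid') auto
  ultimately have "homotopic_paths E a (c +++ b)"
    by (meson homotopic_paths_sym homotopic_paths_trans)
  with c show "\<exists>c. path c \<and> path_image c \<subseteq> B \<and> pathstart c = pathstart a \<and>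
      pathfinish c = pathstart b \<and> homotopic_paths E a (c +++ b)"
    by blast
next
  assume "\<exists>c. path c \<and> path_image c \<subseteq> B \<and> pathstart c = pathstart a \<and>
      pathfinish c = pathstart b \<and> homotopic_paths E a (c +++ b)"
  then obtain c where c: "path c" "path_image c \<subseteq> B" "pathfinish c = pathstart b"
      "homotopic_paths E a (c +++ b)"
    by blast
  show "(a, b) \<in> quandle_path_rel N z"
    using homotopic_paths_rel [OF assms(1) c(4)] prefix_rel [OF assms(2) c(1-3)] equiv_rel
    by (meson equivE transE)
qed

text \<open>
  The square filled by \<open>(s, t) \<mapsto> m (c s) t\<close> has the loops at the two ends of \<open>c\<close> on opposite
  sides and \<open>c\<close> itself on the other two, since the loops are closed.
\<close>

lemma field_transport:
  assumes "path c" "path_image c \<subseteq> B"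
  shows "homotopic_paths B (m (pathstart c) +++ c) (c +++ m (pathfinish c))"
proof -
  have cB: "c t \<in> B" if "t \<in> {0..1}" for t
    using assms(2) that by (rule path_in_imp_mem)
  define H where "H = (\<lambda>(s, t). m (c s) t)"
  have "continuous_on ({0..1} \<times> {0..1}) (\<lambda>q. m (c (fst q)) (snd q))"
  proof (rule continuous_on_field)
    show "continuous_on ({0..1} \<times> {0..1}) (\<lambda>q. c (fst q))"
      by (rule continuous_on_compose2 [OF assms(1) [unfolded path_def] continuous_on_fst])
         (auto intro: continuous_intros)
  qed (use cB in \<open>auto intro: continuous_intros\<close>)
  then have "continuous_on ({0..1} \<times> {0..1}) H"
    by (simp add: H_def case_prod_unfold)
  moreover have "H ` ({0..1} \<times> {0..1}) \<subseteq> B"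
    using cB field_in by (auto simp: H_def)
  ultimately have "homotopic_paths B ((\<lambda>t. H (0, t)) +++ (\<lambda>s. H (s, 1))) ((\<lambda>s. H (s, 0)) +++ (\<lambda>t. H (1, t)))"
    by (rule homotopic_paths_around_square)
  then show ?thesis
    by (rule homotopic_paths_cong)
       (use cB in \<open>auto simp: H_def joinpaths_def pathstart_def pathfinish_def\<close>)
qed

lemma conjugate_loop [simp]:
  assumes "b \<in> Q"
  shows "path (conjugate_loop m b)" "path_image (conjugate_loop m b) \<subseteq> E"
    "pathstart (conjugate_loop m b) = z" "pathfinish (conjugate_loop m b) = z"
  using assms by (auto simp: conjugate_loop_def)

lemma translate_in [simp]:
  assumes "a \<in> Q" "b \<in> Q"
  shows "a +++ conjugate_loop m b \<in> Q"
  using assms by (intro append_loop_in) auto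

text \<open>
  The initial point of \<open>b\<close> may slide along \<open>c\<close>, because \<open>c\<close> conjugates the loop of the field at one
  of its ends into the loop at the other end. So the loop based at \<open>z\<close> depends on the class of \<open>b\<close>
  alone.
\<close>

lemma conjugate_loop_cong:
  assumes "(a, b) \<in> quandle_path_rel N z"
  shows "homotopic_paths E (conjugate_loop m a) (conjugate_loop m b)"
proof -
  have ab [simp]: "a \<in> Q" "b \<in> Q"
    using assms by (auto simp: quandle_path_rel_def)
  then obtain c where c: "path c" "path_image c \<subseteq> B" "pathstart c = pathstart a"
      "pathfinish c = pathstart b" "homotopic_paths E a (c +++ b)"
    using assms rel_iff by blast
  then have cE [simp]: "path_image c \<subseteq> E"
    using boundary_subset by blast
  let ?p = "m (pathstart a)" and ?q = "m (pathstart b)"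
  note [simp] = c(1,3,4)
  have "homotopic_paths E (conjugate_loop m a) (reversepath (c +++ b) +++ ?p +++ (c +++ b))"
    unfolding conjugate_loop_def
    by (intro homotopic_paths_join c(5)) (auto simp: homotopic_paths_reversepath c(5))
  also have "\<dots> = (reversepath b +++ reversepath c) +++ (?p +++ (c +++ b))"
    by (simp add: reversepath_joinpaths)
  also have "homotopic_paths E \<dots> (reversepath b +++ (reversepath c +++ (?p +++ (c +++ b))))"
    by (intro homotopic_paths_sym [OF homotopic_paths_assoc]) auto
  also have "homotopic_paths E \<dots> (reversepath b +++ (reversepath c +++ (c +++ (?q +++ b))))"
  proof (rule homotopic_paths_join [OF _ homotopic_paths_join])
    have "homotopic_paths E (?p +++ (c +++ b)) ((?p +++ c) +++ b)"
      by (intro homotopic_paths_assoc) auto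
    also have "homotopic_paths E \<dots> ((c +++ ?q) +++ b)"
      using homotopic_paths_subset [OF field_transport [OF c(1,2)] boundary_subset, unfolded c(3,4)]
      by (rule homotopic_paths_join [OF _ homotopic_paths_refl [THEN iffD2]]) auto
    also have "homotopic_paths E \<dots> (c +++ (?q +++ b))"
      by (intro homotopic_paths_sym [OF homotopic_paths_assoc]) auto
    finally show "homotopic_paths E (?p +++ (c +++ b)) (c +++ (?q +++ b))" .
  qed auto
  also have "homotopic_paths E \<dots> (reversepath b +++ (?q +++ b))"
    by (rule homotopic_paths_join [OF _ homotopic_paths_cancel_left']) auto
  finally show ?thesis
    by (simp add: conjugate_loop_def)
qed

text \<open>
  The equivariance on which self-distributivity rests: \<open>a \<cdot> l\<close> starts where \<open>a\<close> does, so both paths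
  conjugate the same loop of the field.
\<close>

lemma conjugate_loop_append:
  assumes "a \<in> Q" "path l" "path_image l \<subseteq> E" "pathstart l = z" "pathfinish l = z"
  shows "homotopic_paths E (conjugate_loop m (a +++ l)) (reversepath l +++ (conjugate_loop m a +++ l))"
proof -
  let ?p = "m (pathstart a)"
  note [simp] = assms
  have eq: "conjugate_loop m (a +++ l) = (reversepath l +++ reversepath a) +++ (?p +++ (a +++ l))"
    by (simp add: conjugate_loop_def reversepath_joinpaths)
  have "homotopic_paths E (conjugate_loop m (a +++ l)) (reversepath l +++ (reversepath a +++ (?p +++ (a +++ l))))"
    unfolding eq by (intro homotopic_paths_sym [OF homotopic_paths_assoc]) auto
  also have "homotopic_paths E \<dots> (reversepath l +++ (conjugate_loop m a +++ l))"
  proof (rule homotopic_paths_join)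
    have "homotopic_paths E (conjugate_loop m a +++ l) (reversepath a +++ ((?p +++ a) +++ l))"
      unfolding conjugate_loop_def by (intro homotopic_paths_sym [OF homotopic_paths_assoc]) auto
    also have "homotopic_paths E \<dots> (reversepath a +++ (?p +++ (a +++ l)))"
      by (rule homotopic_paths_join [OF _ homotopic_paths_sym [OF homotopic_paths_assoc]]) auto
    finally show "homotopic_paths E (reversepath a +++ (?p +++ (a +++ l))) (conjugate_loop m a +++ l)"
      by (rule homotopic_paths_sym)
  qed auto
  finally show ?thesis .
qed

lemma conjugate_loop_reverse:
  assumes "b \<in> Q"
  shows "homotopic_paths E (conjugate_loop (\<lambda>p. reversepath (m p)) b) (reversepath (conjugate_loop m b))"
  using assms unfolding conjugate_loop_def
  by (simp add: reversepath_joinpaths) (rule homotopic_paths_assoc; simp)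

lemma translate_cong:
  assumes "(a, a') \<in> quandle_path_rel N z" "(b, b') \<in> quandle_path_rel N z"
  shows "(a +++ conjugate_loop m b, a' +++ conjugate_loop m b') \<in> quandle_path_rel N z"
proof -
  have Q [simp]: "a \<in> Q" "a' \<in> Q" "b \<in> Q" "b' \<in> Q"
    using assms by (auto simp: quandle_path_rel_def)
  then obtain c where c: "path c" "path_image c \<subseteq> B" "pathstart c = pathstart a"
      "pathfinish c = pathstart a'" "homotopic_paths E a (c +++ a')"
    using assms rel_iff by blast
  then have cE: "path_image c \<subseteq> E"
    using boundary_subset by blast
  have "homotopic_paths E (a +++ conjugate_loop m b) ((c +++ a') +++ conjugate_loop m b')"
    by (intro homotopic_paths_join c(5) conjugate_loop_cong assms) simp
  also have "homotopic_paths E \<dots> (c +++ (a' +++ conjugate_loop m b'))"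
    using c cE by (intro homotopic_paths_sym [OF homotopic_paths_assoc]) auto
  finally show ?thesis
    using c by (subst rel_iff) (auto intro!: exI [of _ c])
qed

lemma class_eq_iff:
  assumes "a \<in> Q" "b \<in> Q"
  shows "cl a = cl b \<longleftrightarrow> (a, b) \<in> quandle_path_rel N z"
  unfolding quandle_class_def using eq_equiv_class_iff [OF equiv_rel assms] .

lemma class_eqI:
  assumes "a \<in> Q" "homotopic_paths E a b"
  shows "cl a = cl b"
  using class_eq_iff homotopic_paths_rel homotopic_paths_in assms by blast

lemma carrier_cases:
  assumes "A \<in> Q // quandle_path_rel N z"
  obtains a where "a \<in> Q" "A = cl a"
  using assms unfolding quandle_class_def by (rule quotientE)

lemma class_in_carrier [simp]: "a \<in> Q \<Longrightarrow> cl a \<in> Q // quandle_path_rel N z"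
  unfolding quandle_class_def by (rule quotientI)

lemma class_operation_class [simp]:
  assumes "a \<in> Q" "b \<in> Q"
  shows "class_operation N z m (cl a) (cl b) = cl (a +++ conjugate_loop m b)"
proof -
  have eq: "cl (a' +++ conjugate_loop m b') = cl (a +++ conjugate_loop m b)"
    if "a' \<in> cl a" "b' \<in> cl b" for a' b'
  proof -
    have *: "(a, a') \<in> quandle_path_rel N z" "(b, b') \<in> quandle_path_rel N z"
      using that by (auto simp: quandle_class_def)
    then have "(a +++ conjugate_loop m b, a' +++ conjugate_loop m b') \<in> quandle_path_rel N z"
      by (rule translate_cong)
    then show ?thesis
      unfolding quandle_class_def by (rule equiv_class_eq [OF equiv_rel, symmetric])
  qed
  have ne: "cl a \<noteq> {}" "cl b \<noteq> {}"
    using equiv_class_self [OF equiv_rel] assms unfolding quandle_class_def by blast+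
  have "class_operation N z m (cl a) (cl b) =
      (\<Union>a'\<in>cl a. \<Union>b'\<in>cl b. cl (a +++ conjugate_loop m b))"
    unfolding class_operation_def by (intro SUP_cong refl eq)
  also have "\<dots> = cl (a +++ conjugate_loop m b)"
    using ne by simp
  finally show ?thesis .
qed

text \<open>
  Here \<open>a \<cdot> reverse a\<close> cancels, and the remaining \<open>m (a 0)\<close> lies in the torus, where it is absorbed
  by sliding the initial point once around it.
\<close>

lemma translate_self:
  assumes "a \<in> Q"
  shows "cl (a +++ conjugate_loop m a) = cl a"
proof -
  have "homotopic_paths E (a +++ conjugate_loop m a) (m (pathstart a) +++ a)"
    unfolding conjugate_loop_def
    using assms by (intro homotopic_paths_cancel_left) auto
  then have "cl (a +++ conjugate_loop m a) = cl (m (pathstart a) +++ a)"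
    using assms by (intro class_eqI) auto
  moreover have "(m (pathstart a) +++ a, a) \<in> quandle_path_rel N z"
    using assms field_image_boundary by (intro prefix_rel) auto
  then have "cl (m (pathstart a) +++ a) = cl a"
    unfolding quandle_class_def by (rule equiv_class_eq [OF equiv_rel])
  ultimately show ?thesis
    by simp
qed

lemma translate_distrib:
  assumes "x \<in> Q" "y \<in> Q" "w \<in> Q"
  shows "cl ((x +++ conjugate_loop m y) +++ conjugate_loop m w) =
         cl ((x +++ conjugate_loop m w) +++ conjugate_loop m (y +++ conjugate_loop m w))"
proof -
  let ?y = "conjugate_loop m y" and ?w = "conjugate_loop m w"
  note [simp] = assms
  have "homotopic_paths E ((x +++ ?w) +++ conjugate_loop m (y +++ ?w))
      ((x +++ ?w) +++ (reversepath ?w +++ (?y +++ ?w)))"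
    by (intro homotopic_paths_join conjugate_loop_append) auto
  also have "homotopic_paths E \<dots> (x +++ (?w +++ (reversepath ?w +++ (?y +++ ?w))))"
    by (intro homotopic_paths_sym [OF homotopic_paths_assoc]) auto
  also have "homotopic_paths E \<dots> (x +++ (?y +++ ?w))"
    by (rule homotopic_paths_join [OF _ homotopic_paths_cancel_left]) auto
  also have "homotopic_paths E \<dots> ((x +++ ?y) +++ ?w)"
    by (intro homotopic_paths_assoc) auto
  finally show ?thesis
    by (intro class_eqI [symmetric]) auto
qed

lemma translate_inverse:
  assumes "a \<in> Q" "b \<in> Q"
  shows "cl ((a +++ conjugate_loop m b) +++ conjugate_loop (\<lambda>p. reversepath (m p)) b) = cl a"
    and "cl ((a +++ conjugate_loop (\<lambda>p. reversepath (m p)) b) +++ conjugate_loop m b) = cl a"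
proof -
  interpret rev: boundary_loop_field N z "\<lambda>p. reversepath (m p)"
    by (rule reverse_field)
  let ?l = "conjugate_loop m b" and ?r = "conjugate_loop (\<lambda>p. reversepath (m p)) b"
  note [simp] = assms
  have "homotopic_paths E ((a +++ ?l) +++ ?r) ((a +++ ?l) +++ reversepath ?l)"
    by (intro homotopic_paths_join conjugate_loop_reverse) auto
  also have "homotopic_paths E \<dots> a"
    by (intro homotopic_paths_cancel_right) auto
  finally show "cl ((a +++ ?l) +++ ?r) = cl a"
    by (intro class_eqI) auto
  have "homotopic_paths E ((a +++ ?r) +++ ?l) ((a +++ reversepath ?l) +++ reversepath (reversepath ?l))"
    by (intro homotopic_paths_join conjugate_loop_reverse) auto
  also have "homotopic_paths E \<dots> a"
    by (intro homotopic_paths_cancel_right) auto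
  finally show "cl ((a +++ ?r) +++ ?l) = cl a"
    by (intro class_eqI) auto
qed

abbreviation "loop_quandle \<equiv>
  \<lparr> qcarrier = Q // quandle_path_rel N z,
    rhd = class_operation N z m,
    lhd = class_operation N z (\<lambda>p. reversepath (m p)) \<rparr>"

lemma quandle_loop_quandle: "quandle loop_quandle"
proof -
  interpret rev: boundary_loop_field N z "\<lambda>p. reversepath (m p)"
    by (rule reverse_field)
  have "Q // quandle_path_rel N z \<noteq> {}"
    using paths_nonempty by (auto simp: quotient_def)
  then show ?thesis
    unfolding quandle_def
    by (intro conjI ballI)
       (auto elim!: carrier_cases simp: translate_self translate_inverse translate_distrib [symmetric])
qed

section \<open>Induced maps\<close>

text \<open>
  A free homotopy of loops moves the base point along a path \<open>c\<close> and gives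
  \<open>(f \<circ> m p) \<cdot> c \<simeq> c \<cdot> m' p\<close>. Transport of the field \<open>m'\<close> along the same \<open>c\<close> gives
  \<open>m' (f p) \<cdot> c \<simeq> c \<cdot> m' p\<close>, and \<open>c\<close> cancels.
\<close>

lemma field_image_homotopic:
  assumes m': "boundary_loop_field N z m'"
    and free: "homotopic_loops B (f \<circ> m p) (m' p)" and p: "p \<in> B" "f p \<in> B"
  shows "homotopic_paths B (f \<circ> m p) (m' (f p))"
proof -
  interpret m': boundary_loop_field N z m'
    by (rule m')
  obtain H :: "real \<times> real \<Rightarrow> real^4" where "continuous_on ({0..1} \<times> {0..1}) H" "H \<in> {0..1} \<times> {0..1} \<rightarrow> B"
      "\<forall>x\<in>{0..1}. H (0, x) = (f \<circ> m p) x" "\<forall>x\<in>{0..1}. H (1, x) = m' p x"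
      "\<forall>t\<in>{0..1}. pathfinish (H \<circ> Pair t) = pathstart (H \<circ> Pair t)"
    using free [unfolded homotopic_loops] by blast
  then have H: "continuous_on ({0..1} \<times> {0..1}) H" "H ` ({0..1} \<times> {0..1}) \<subseteq> B"
      "\<And>x. x \<in> {0..1} \<Longrightarrow> H (0, x) = f (m p x)" "\<And>x. x \<in> {0..1} \<Longrightarrow> H (1, x) = m' p x"
      "\<And>s. s \<in> {0..1} \<Longrightarrow> H (s, 1) = H (s, 0)"
    by (auto simp: pathstart_def pathfinish_def)
  define c where "c = (\<lambda>s. H (s, 0))"
  have c: "path c" "path_image c \<subseteq> B" "pathstart c = f p" "pathfinish c = p"
  proof -
    show "path c"
      unfolding c_def path_def
      by (rule continuous_on_compose2 [OF H(1)]) (auto intro!: continuous_intros)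
    show "path_image c \<subseteq> B"
      using H(2) by (auto simp: c_def path_image_def)
  qed (use H(3) [of 0] H(4) [of 0] p in \<open>simp_all add: c_def pathstart_def pathfinish_def\<close>)
  have fm: "path (f \<circ> m p)" "path_image (f \<circ> m p) \<subseteq> B"
    using homotopic_loops_imp_path [OF free] homotopic_loops_imp_subset [OF free] by auto
  have ends: "pathstart (f \<circ> m p) = f p" "pathfinish (f \<circ> m p) = f p"
    using p by (simp_all add: pathstart_def pathfinish_def)
  have m'B: "path_image (m' (f p)) \<subseteq> B"
    using p m'.field_image_boundary by blast
  have "homotopic_paths B ((f \<circ> m p) +++ c) (c +++ m' p)"
    using homotopic_paths_around_square [OF H(1,2)]
    by (rule homotopic_paths_cong) (auto simp: c_def joinpaths_def H(3-5))
  also have "homotopic_paths B \<dots> (m' (f p) +++ c)"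
    using m'.field_transport [OF c(1,2)] unfolding c(3,4) by (rule homotopic_paths_sym)
  finally have *: "homotopic_paths B ((f \<circ> m p) +++ c) (m' (f p) +++ c)" .
  have "homotopic_paths B (f \<circ> m p) (((f \<circ> m p) +++ c) +++ reversepath c)"
    using c fm ends by (intro homotopic_paths_sym [OF homotopic_paths_cancel_right]) auto
  also have "homotopic_paths B \<dots> ((m' (f p) +++ c) +++ reversepath c)"
    using c by (intro homotopic_paths_join *) auto
  also have "homotopic_paths B \<dots> (m' (f p))"
    using c p m'B by (intro homotopic_paths_cancel_right) auto
  finally show ?thesis .
qed

lemma compose_in:
  assumes "continuous_on E f" "f ` E \<subseteq> E" "f ` B \<subseteq> B" "f z = z" "a \<in> Q"
  shows "f \<circ> a \<in> Q"
proof (rule quandle_pathsI)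
  have a: "path a" "path_image a \<subseteq> E" "pathstart a \<in> B" "pathfinish a = z"
    using assms(5) by simp_all
  show "path (f \<circ> a)" "path_image (f \<circ> a) \<subseteq> E"
    using path_compose_in [OF assms(1,2) a(1,2)] .
  show "pathstart (f \<circ> a) \<in> B" "pathfinish (f \<circ> a) = z"
    using a assms(3,4) by (auto simp: pathstart_compose pathfinish_compose)
qed

lemma compose_rel:
  assumes "continuous_on E f" "f ` E \<subseteq> E" "f ` B \<subseteq> B" "f z = z"
    and rel: "(a, b) \<in> quandle_path_rel N z"
  shows "(f \<circ> a, f \<circ> b) \<in> quandle_path_rel N z"
proof -
  let ?P = "\<lambda>c. pathstart c \<in> B \<and> pathfinish c = z"
  have ab: "a \<in> Q" "b \<in> Q" and hom: "homotopic_with_canon ?P {0..1} E a b"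
    using rel unfolding quandle_path_rel_def by blast+
  have "homotopic_with_canon (\<lambda>c. ?P (f \<circ> c)) {0..1} E a b"
    using hom by (rule homotopic_with_mono)
      (use assms(3,4) in \<open>auto simp: pathstart_compose pathfinish_compose\<close>)
  then have "homotopic_with_canon ?P {0..1} E (f \<circ> a) (f \<circ> b)"
    using assms(1,2) by (intro homotopic_with_compose_continuous_left [where Y = E]) auto
  then show ?thesis
    using compose_in [OF assms(1-4)] ab unfolding quandle_path_rel_def by blast
qed

text \<open>
  A union over representatives, so that no choice is made; \<open>induced_map_class\<close> shows that all
  members of the union agree.
\<close>

definition induced_map :: "(real^4 \<Rightarrow> real^4) \<Rightarrow> (real \<Rightarrow> real^4) set \<Rightarrow> (real \<Rightarrow> real^4) set" where
  "induced_map f A = (\<Union>a\<in>A. cl (f \<circ> a))"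

lemma induced_map_class:
  assumes "continuous_on E f" "f ` E \<subseteq> E" "f ` B \<subseteq> B" "f z = z" and a: "a \<in> Q"
  shows "induced_map f (cl a) = cl (f \<circ> a)"
proof -
  have eq: "cl (f \<circ> a') = cl (f \<circ> a)" if "a' \<in> cl a" for a'
  proof -
    have "(a, a') \<in> quandle_path_rel N z"
      using that by (simp add: quandle_class_def)
    then have "(f \<circ> a, f \<circ> a') \<in> quandle_path_rel N z"
      by (rule compose_rel [OF assms(1-4)])
    then show ?thesis
      unfolding quandle_class_def by (rule equiv_class_eq [OF equiv_rel, symmetric])
  qed
  have ne: "cl a \<noteq> {}"
    using equiv_class_self [OF equiv_rel a] unfolding quandle_class_def by blast
  have "induced_map f (cl a) = (\<Union>a'\<in>cl a. cl (f \<circ> a))"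
    unfolding induced_map_def by (intro SUP_cong refl eq)
  with ne show ?thesis by simp
qed

lemma induced_map_operation:
  assumes f: "continuous_on E f" "f ` E \<subseteq> E" "f ` B \<subseteq> B" "f z = z"
    and m': "boundary_loop_field N z m'"
    and free: "\<And>p. p \<in> B \<Longrightarrow> homotopic_loops B (f \<circ> m p) (m' p)"
    and ab [simp]: "a \<in> Q" "b \<in> Q"
  shows "induced_map f (class_operation N z m (cl a) (cl b)) =
    class_operation N z m' (induced_map f (cl a)) (induced_map f (cl b))"
proof -
  interpret m': boundary_loop_field N z m'
    by (rule m')
  note [simp] = compose_in [OF f]
  let ?p = "pathstart b"
  have p: "?p \<in> B"
    by simp
  with f(3) have fp: "f ?p \<in> B"
    by blast
  have "homotopic_paths E (f \<circ> m ?p) (m' (f ?p))"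
    by (rule homotopic_paths_subset [OF field_image_homotopic [OF m' free [OF p] p fp] boundary_subset])
  then have "homotopic_paths E (reversepath (f \<circ> b) +++ (f \<circ> m ?p) +++ (f \<circ> b))
      (reversepath (f \<circ> b) +++ m' (f ?p) +++ (f \<circ> b))"
    using compose_in [OF f ab(2)]
    by (intro homotopic_paths_join) (auto simp: pathfinish_compose pathstart_compose)
  then have "homotopic_paths E (f \<circ> conjugate_loop m b) (conjugate_loop m' (f \<circ> b))"
    by (simp add: conjugate_loop_def path_compose_join path_compose_reversepath pathstart_compose)
  then have "homotopic_paths E ((f \<circ> a) +++ (f \<circ> conjugate_loop m b)) ((f \<circ> a) +++ conjugate_loop m' (f \<circ> b))"
    using compose_in [OF f ab(1)] f(4)
    by (intro homotopic_paths_join) (auto simp: pathfinish_compose pathstart_compose)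
  moreover have "(f \<circ> a) +++ (f \<circ> conjugate_loop m b) \<in> Q"
    using compose_in [OF f translate_in [OF ab]] by (simp add: path_compose_join)
  ultimately have "cl ((f \<circ> a) +++ (f \<circ> conjugate_loop m b)) = cl ((f \<circ> a) +++ conjugate_loop m' (f \<circ> b))"
    by (intro class_eqI)
  then show ?thesis
    by (simp add: induced_map_class [OF f] path_compose_join)
qed

lemma induced_map_bij:
  assumes f: "continuous_on E f" "f ` E \<subseteq> E" "f ` B \<subseteq> B" "f z = z"
    and g: "continuous_on E g" "g ` E \<subseteq> E" "g ` B \<subseteq> B" "g z = z"
    and gf: "\<And>x. x \<in> E \<Longrightarrow> g (f x) = x" and fg: "\<And>x. x \<in> E \<Longrightarrow> f (g x) = x"
  shows "bij_betw (induced_map f) (Q // quandle_path_rel N z) (Q // quandle_path_rel N z)"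
proof -
  have inv: "cl (v \<circ> (u \<circ> a)) = cl a" if "a \<in> Q" "\<And>x. x \<in> E \<Longrightarrow> v (u x) = x" for a and u v :: "real^4 \<Rightarrow> real^4"
  proof (rule class_eqI [symmetric])
    have "a t \<in> E" if "t \<in> {0..1}" for t
      using quandle_pathsD(2) [OF \<open>a \<in> Q\<close>] that by (rule path_in_imp_mem)
    then show "homotopic_paths E a (v \<circ> (u \<circ> a))"
      using that by (intro homotopic_paths_eq) auto
  qed (rule that)
  show ?thesis
  proof (rule bij_betw_byWitness [where f' = "induced_map g"])
    show "\<forall>A\<in>Q // quandle_path_rel N z. induced_map g (induced_map f A) = A"
      using inv gf by (auto elim!: carrier_cases simp: induced_map_class [OF f] induced_map_class [OF g] compose_in [OF f])
    show "\<forall>A\<in>Q // quandle_path_rel N z. induced_map f (induced_map g A) = A"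
      using inv fg by (auto elim!: carrier_cases simp: induced_map_class [OF f] induced_map_class [OF g] compose_in [OF g])
    show "induced_map f ` (Q // quandle_path_rel N z) \<subseteq> Q // quandle_path_rel N z"
      by (auto elim!: carrier_cases simp: induced_map_class [OF f] compose_in [OF f])
    show "induced_map g ` (Q // quandle_path_rel N z) \<subseteq> Q // quandle_path_rel N z"
      by (auto elim!: carrier_cases simp: induced_map_class [OF g] compose_in [OF g])
  qed
qed

end

section \<open>The boundary torus and its meridians\<close>

lemma boundary_subset_exterior: "boundary_torus N \<subseteq> exterior N"
  unfolding boundary_torus_def exterior_def frontier_of_def
  using closure_of_subset_topspace by fastforce

lemma regular_neighborhoodD:
  assumes "regular_neighborhood K \<nu> N"
  shows "homeomorphic_map (top_of_set (S1 \<times> UNIV)) (top_of_set (\<nu> ` (S1 \<times> UNIV))) \<nu>"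
    and "continuous_on (S1 \<times> UNIV) \<nu>" and "inj_on \<nu> (S1 \<times> UNIV)" and "\<nu> ` (S1 \<times> UNIV) \<subseteq> S3"
    and "open_map (top_of_set (S1 \<times> UNIV)) (top_of_set S3) \<nu>"
    and "\<nu> ` (S1 \<times> {0}) = K" and "\<nu> ` (S1 \<times> cball 0 1) = N"
proof -
  let ?C = "S1 \<times> (UNIV :: complex set)"
  have emb: "homeomorphic_map (top_of_set ?C) (subtopology (top_of_set S3) (\<nu> ` ?C)) \<nu>"
    using assms by (simp add: regular_neighborhood_def embedding_map_def)
  show op: "open_map (top_of_set ?C) (top_of_set S3) \<nu>" and "\<nu> ` (S1 \<times> {0}) = K" "\<nu> ` (S1 \<times> cball 0 1) = N"
    using assms by (simp_all add: regular_neighborhood_def)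
  show im: "\<nu> ` ?C \<subseteq> S3"
    using open_map_imp_subset_topspace [OF op] by auto
  then show hom: "homeomorphic_map (top_of_set ?C) (top_of_set (\<nu> ` ?C)) \<nu>"
    using emb by (simp add: subtopology_subtopology Int_absorb1)
  show "continuous_on ?C \<nu>"
    using homeomorphic_imp_continuous_map [OF hom] by simp
  show "inj_on \<nu> ?C"
    using homeomorphic_imp_injective_map [OF hom] by simp
qed

lemma regular_neighborhood_compact:
  assumes "regular_neighborhood K \<nu> N"
  shows "compact N" "N \<subseteq> S3"
proof -
  note cont = regular_neighborhoodD(2) [OF assms] and im = regular_neighborhoodD(4) [OF assms]
    and N = regular_neighborhoodD(7) [OF assms, symmetric]
  show "compact N"
    unfolding N by (intro compact_continuous_image compact_Times continuous_on_subset [OF cont]) auto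
  show "N \<subseteq> S3"
    using N im by blast
qed

text \<open>
  The interior of \<open>N\<close> is the image of the open disc bundle: because \<open>\<nu>\<close> is an open embedding,
  interiors may be computed in \<open>S1 \<times> \<complex>\<close>.
\<close>

lemma boundary_torus_eq:
  assumes rn: "regular_neighborhood K \<nu> N"
  shows "boundary_torus N = \<nu> ` (S1 \<times> S1)"
proof -
  let ?C = "S1 \<times> (UNIV :: complex set)"
  note cont = regular_neighborhoodD(2) [OF rn] and inj = regular_neighborhoodD(3) [OF rn]
    and im = regular_neighborhoodD(4) [OF rn] and op = regular_neighborhoodD(5) [OF rn]
    and N = regular_neighborhoodD(7) [OF rn, symmetric]
  have 1: "\<nu> ` (S1 \<times> ball 0 1) \<subseteq> (top_of_set S3) interior_of N"
  proof (rule interior_of_maximal)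
    have "openin (top_of_set ?C) (S1 \<times> ball 0 1)"
      by (auto simp: openin_open intro!: exI [of _ "UNIV \<times> ball 0 1"] open_Times)
    then show "openin (top_of_set S3) (\<nu> ` (S1 \<times> ball 0 1))"
      using op by (simp add: open_map_def)
  qed (auto simp: N)
  \<comment> \<open>A point of the unit circle bundle is a limit of points \<open>(u, r * v)\<close> with \<open>r > 1\<close>, which \<open>\<nu>\<close> maps
    outside of \<open>N\<close>.\<close>
  have 2: "\<nu> (u, v) \<notin> (top_of_set S3) interior_of N" if "u \<in> S1" "norm v = 1" for u v
  proof
    assume *: "\<nu> (u, v) \<in> (top_of_set S3) interior_of N"
    define W where "W = {r :: real. \<nu> (u, of_real r * v) \<in> (top_of_set S3) interior_of N}"
    have "openin (top_of_set S3) ((top_of_set S3) interior_of N)"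
      by (rule openin_interior_of)
    then obtain T where T: "open T" "(top_of_set S3) interior_of N = S3 \<inter> T"
      unfolding openin_open by blast
    have cr: "continuous_on UNIV (\<lambda>r::real. \<nu> (u, of_real r * v))"
      by (rule continuous_on_compose2 [OF cont]) (use that in \<open>auto intro!: continuous_intros\<close>)
    have "\<nu> (u, w) \<in> S3" for w
      using that(1) by (intro subsetD [OF im] imageI) auto
    then have "W = (\<lambda>r. \<nu> (u, of_real r * v)) -` T"
      unfolding W_def T(2) by blast
    then have "open W"
      using open_vimage [OF T(1) cr] by simp
    moreover have "1 \<in> W"
      using * by (simp add: W_def)
    ultimately obtain e where e: "e > 0" "ball 1 e \<subseteq> W"
      by (meson openE)
    then have "1 + e / 2 \<in> W"
      by (intro subsetD [OF e(2)]) (auto simp: dist_real_def)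
    then have "\<nu> (u, of_real (1 + e / 2) * v) \<in> N"
      using interior_of_subset unfolding W_def by fastforce
    then obtain u' v' where uv: "u' \<in> S1" "norm v' \<le> 1" "\<nu> (u, of_real (1 + e / 2) * v) = \<nu> (u', v')"
      unfolding N by auto
    then have "(u, of_real (1 + e / 2) * v) = (u', v')"
      by (intro inj_onD [OF inj]) (use that in auto)
    then have "norm (of_real (1 + e / 2) * v) \<le> 1"
      using uv(2) by simp
    then have "\<bar>1 + e / 2\<bar> \<le> 1"
      using that(2) by (simp add: norm_mult del: of_real_add of_real_divide)
    then show False
      using e(1) by simp
  qed
  have "closedin (top_of_set S3) N"
    using regular_neighborhood_compact [OF rn] by (simp add: closed_subset compact_imp_closed)
  then have "boundary_torus N = N - (top_of_set S3) interior_of N"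
    by (simp add: boundary_torus_def frontier_of_def closure_of_closedin)
  also have "\<dots> = \<nu> ` (S1 \<times> S1)"
  proof (intro equalityI subsetI)
    fix x assume x: "x \<in> N - (top_of_set S3) interior_of N"
    then obtain u v where uv: "u \<in> S1" "norm v \<le> 1" "x = \<nu> (u, v)"
      unfolding N by auto
    have "norm v = 1"
    proof (rule ccontr)
      assume "norm v \<noteq> 1"
      then have "(u, v) \<in> S1 \<times> ball 0 1"
        using uv by auto
      then show False
        using 1 x uv(3) by blast
    qed
    then show "x \<in> \<nu> ` (S1 \<times> S1)"
      using uv by auto
  next
    fix x assume "x \<in> \<nu> ` (S1 \<times> S1)"
    then show "x \<in> N - (top_of_set S3) interior_of N"
      using 2 unfolding N by auto
  qed
  finally show ?thesis .
qed

text \<open>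
  The exterior is joined to the torus by the part of a path in the 3-sphere from \<open>z\<close> to the
  knot up to its first point in \<open>N\<close>.
\<close>

lemma quandle_paths_nonempty:
  assumes rn: "regular_neighborhood K \<nu> N" and z: "z \<in> exterior N"
  shows "quandle_paths N z \<noteq> {}"
proof -
  let ?J = "(top_of_set S3) interior_of N"
  have N: "compact N" "N \<subseteq> S3"
    using regular_neighborhood_compact [OF rn] by auto
  have "\<nu> (1, 0) \<in> N"
    unfolding regular_neighborhoodD(7) [OF rn, symmetric] by (rule imageI) auto
  then have nS: "\<nu> (1, 0) \<in> S3"
    using N(2) by blast
  have zS: "z \<in> S3" "z \<notin> ?J"
    using z by (auto simp: exterior_def)
  have "path_connected S3"
    by (intro path_connected_sphere) simp
  then have "\<exists>g. path g \<and> path_image g \<subseteq> S3 \<and> pathstart g = z \<and> pathfinish g = \<nu> (1, 0)"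
    unfolding path_connected_def using zS(1) nS by blast
  then obtain g where g: "path g" "path_image g \<subseteq> S3" "pathstart g = z" "pathfinish g \<in> N"
    using \<open>\<nu> (1, 0) \<in> N\<close> by auto
  have gS: "g t \<in> S3" if "t \<in> {0..1}" for t
    using g(2) that by (rule path_in_imp_mem)
  define T where "T = {t \<in> {0..1}. g t \<in> N}"
  have cont: "continuous_on {0..1} g"
    using g(1) by (simp add: path_def)
  have "compact T"
  proof -
    have "closed ({0..1} \<inter> g -` N)"
      using cont N(1) by (intro continuous_closed_preimage compact_imp_closed) auto
    moreover have "T = {0..1} \<inter> ({0..1} \<inter> g -` N)"
      by (auto simp: T_def)
    ultimately show ?thesis
      by (metis compact_Icc compact_Int_closed)
  qed
  moreover have "1 \<in> T"
    using g(4) by (simp add: T_def pathfinish_def)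
  ultimately obtain u where u: "u \<in> T" "\<And>t. t \<in> T \<Longrightarrow> u \<le> t"
    using compact_attains_inf [of T] by blast
  then have u01: "u \<in> {0..1}" and gu: "g u \<in> N"
    by (auto simp: T_def)
  have before: "g t \<notin> N" if "0 \<le> t" "t < u" for t
    using u(2) [of t] u01 that by (auto simp: T_def)
  have nJ: "g u \<notin> ?J"
  proof
    assume J: "g u \<in> ?J"
    have "u \<noteq> 0"
      using J zS(2) g(3) by (auto simp: pathstart_def)
    then have "u > 0"
      using u01 by auto
    obtain V where V: "open V" "?J = S3 \<inter> V"
      using openin_interior_of [of "top_of_set S3" N] unfolding openin_open by blast
    obtain d where d: "d > 0" "\<And>t. t \<in> {0..1} \<Longrightarrow> dist t u < d \<Longrightarrow> g t \<in> V"
    proof -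
      have "g u \<in> V"
        using J V(2) by blast
      then obtain e where e: "e > 0" "ball (g u) e \<subseteq> V"
        by (rule openE [OF V(1)])
      obtain d where "d > 0" "\<forall>t\<in>{0..1}. dist t u < d \<longrightarrow> dist (g t) (g u) < e"
        using cont u01 e(1) unfolding continuous_on_iff by blast
      then show thesis
        using e(2) by (intro that [of d]) (auto simp: dist_commute)
    qed
    define t where "t = max 0 (u - d / 2)"
    have t: "t \<in> {0..1}" "0 \<le> t" "t < u" "dist t u < d"
      using u01 \<open>u > 0\<close> d(1) by (auto simp: t_def dist_real_def)
    then have "g t \<in> ?J"
      unfolding V(2) using d(2) [OF t(1,4)] gS [OF t(1)] by simp
    then have "g t \<in> N"
      by (rule subsetD [OF interior_of_subset])
    then show False
      using before [OF t(2,3)] by contradiction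
  qed
  have "closedin (top_of_set S3) N"
    using N by (simp add: closed_subset compact_imp_closed)
  then have B: "g u \<in> boundary_torus N"
    using gu nJ by (simp add: boundary_torus_def frontier_of_def closure_of_closedin)
  have "g t \<in> exterior N" if "t \<in> {0..u}" for t
    using that before [of t] nJ gS [of t] u01 interior_of_subset [of "top_of_set S3" N]
    by (cases "t = u") (auto simp: exterior_def)
  then have "path_image (subpath u 0 g) \<subseteq> exterior N"
    using u01 by (auto simp: path_image_subpath_gen closed_segment_eq_real_ivl)
  then have "subpath u 0 g \<in> quandle_paths N z"
    using g(1,3) u01 B by (auto simp: quandle_paths_def pathstart_def [of g])
  then show ?thesis
    by blast
qed

text \<open>
  In the coordinates of \<open>\<nu>\<close> the meridian through \<open>(u, v)\<close> turns \<open>v\<close> once around the circle, so it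
  depends continuously on the point and closes up.
\<close>

lemma meridian_loop_field:
  assumes rn: "regular_neighborhood K \<nu> N" and no: "normal_orientation K \<epsilon>" and z: "z \<in> exterior N"
  shows "boundary_loop_field N z (meridian \<nu> \<epsilon>)"
proof
  let ?C = "S1 \<times> (UNIV :: complex set)" and ?B = "boundary_torus N"
  note emb = regular_neighborhoodD(1) [OF rn] and cont = regular_neighborhoodD(2) [OF rn]
    and inj = regular_neighborhoodD(3) [OF rn] and K = regular_neighborhoodD(6) [OF rn]
  define g where "g = inv_into ?C \<nu>"
  have g [simp]: "g (\<nu> (u, v)) = (u, v)" if "norm u = 1" for u v
    unfolding g_def by (rule inv_into_f_f [OF inj]) (use that in auto)
  have cg: "continuous_on (\<nu> ` ?C) g"
  proof -
    obtain k where k: "homeomorphic_maps (top_of_set ?C) (top_of_set (\<nu> ` ?C)) \<nu> k"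
      using emb by (auto simp: homeomorphic_map_maps)
    then have ck: "continuous_on (\<nu> ` ?C) k" and "\<And>x. x \<in> ?C \<Longrightarrow> k (\<nu> x) = x"
      by (auto simp: homeomorphic_maps_def)
    then have "k x = g x" if "x \<in> \<nu> ` ?C" for x
      using that inv_into_f_f [OF inj] by (auto simp: g_def)
    then show ?thesis
      by (rule continuous_on_eq [OF ck])
  qed
  have B: "?B = \<nu> ` (S1 \<times> S1)"
    by (rule boundary_torus_eq [OF rn])
  have eps: "continuous_on K \<epsilon>" "\<And>x. x \<in> K \<Longrightarrow> \<epsilon> x = 1 \<or> \<epsilon> x = -1"
    using no by (auto simp: normal_orientation_def)
  have mer: "meridian \<nu> \<epsilon> p t =
      \<nu> (fst (g p), cis (2 * pi * \<epsilon> (\<nu> (fst (g p), 0)) * t) * snd (g p))" for p t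
    by (simp add: meridian_def g_def Let_def case_prod_unfold)
  show "quandle_paths N z \<noteq> {}"
    by (rule quandle_paths_nonempty [OF rn z])
  show "?B \<subseteq> exterior N"
    by (rule boundary_subset_exterior)
  show "continuous_on (?B \<times> {0..1}) (\<lambda>(p, t). meridian \<nu> \<epsilon> p t)"
  proof -
    let ?D = "?B \<times> {0..1} :: ((real^4) \<times> real) set"
    have 1: "continuous_on ?D (\<lambda>q. g (fst q))"
    proof (rule continuous_on_compose2 [OF cg])
      show "continuous_on ?D fst"
        by (intro continuous_intros)
      have "?B \<subseteq> \<nu> ` ?C"
        unfolding B by (intro image_mono) auto
      then show "fst ` ?D \<subseteq> \<nu> ` ?C"
        by auto
    qed
    have gB: "norm (fst (g p)) = 1" if "p \<in> ?B" for p
      using that unfolding B by auto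
    then have gK: "\<nu> (fst (g p), 0) \<in> K" if "p \<in> ?B" for p
      using that unfolding K [symmetric] by auto
    have 2: "continuous_on ?D (\<lambda>q. \<nu> (fst (g (fst q)), 0))"
      by (rule continuous_on_compose2 [OF cont]) (use gB in \<open>auto intro!: continuous_intros 1\<close>)
    have 3: "continuous_on ?D (\<lambda>q. \<epsilon> (\<nu> (fst (g (fst q)), 0)))"
      by (rule continuous_on_compose2 [OF eps(1) 2]) (use gK in auto)
    have "continuous_on ?D (\<lambda>q. \<nu> (fst (g (fst q)),
        cis (2 * pi * \<epsilon> (\<nu> (fst (g (fst q)), 0)) * snd q) * snd (g (fst q))))"
      by (rule continuous_on_compose2 [OF cont])
         (use gB in \<open>auto intro!: continuous_intros 1 3\<close>)
    then show ?thesis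
      by (simp add: mer case_prod_unfold)
  qed
  fix p assume "p \<in> ?B"
  then obtain u v where p: "p = \<nu> (u, v)" "norm u = 1" "norm v = 1"
    unfolding B by auto
  show "meridian \<nu> \<epsilon> p t \<in> ?B" for t
    unfolding B using p by (auto simp: mer norm_mult intro!: imageI)
  show "meridian \<nu> \<epsilon> p 0 = p"
    using p by (simp add: mer)
  \<comment> \<open>The meridian closes up because the orientation sign at \<open>u\<close> is an integer.\<close>
  have "\<nu> (u, 0) \<in> K"
    using p K by auto
  then have "cis (2 * pi * \<epsilon> (\<nu> (u, 0))) = 1"
    using eps(2) [of "\<nu> (u, 0)"] by (auto simp: complex_eq_iff)
  then show "meridian \<nu> \<epsilon> p 1 = p"
    using p by (simp add: mer)
qed

section \<open>The action of the homeomorphism\<close>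

lemma homotopic_loops_cong:
  assumes "homotopic_loops S p q"
    and "\<And>t. t \<in> {0..1} \<Longrightarrow> p t = p' t" "\<And>t. t \<in> {0..1} \<Longrightarrow> q t = q' t"
  shows "homotopic_loops S p' q'"
proof -
  have "homotopic_loops S p p'" "homotopic_loops S q q'"
    using homotopic_loops_imp_path [OF assms(1)] homotopic_loops_imp_subset [OF assms(1)]
      homotopic_loops_imp_loop [OF assms(1)] assms(2,3)
    by (auto intro: homotopic_loops_eq)
  then show ?thesis
    using assms(1) by (meson homotopic_loops_sym homotopic_loops_trans)
qed

text \<open>
  Only the homotopy class of \<open>f\<close> on the torus matters for free homotopy classes of loops, and
  these may be compared after transport by \<open>h\<close> to the standard torus.
\<close>

lemma homotopic_loops_torus_map:
  fixes f :: "'a::real_normed_vector \<Rightarrow> 'a"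
  assumes h: "homeomorphic_maps (top_of_set B) T2 h h'" and fB: "f ` B \<subseteq> B"
    and iso: "isotopic T2 (h \<circ> f \<circ> h') k"
    and g: "path g" "path_image g \<subseteq> B" "pathfinish g = pathstart g"
    and k: "homotopic_loops (S1 \<times> S1) (k \<circ> (h \<circ> g)) (h \<circ> g')"
    and g': "\<And>t. t \<in> {0..1} \<Longrightarrow> g' t \<in> B"
  shows "homotopic_loops B (f \<circ> g) g'"
proof -
  have ch: "continuous_on B h" "h \<in> B \<rightarrow> S1 \<times> S1" and ch': "continuous_on (S1 \<times> S1) h'" "h' \<in> S1 \<times> S1 \<rightarrow> B"
    and h'h: "\<And>x. x \<in> B \<Longrightarrow> h' (h x) = x"
    using h by (auto simp: homeomorphic_maps_def)
  have hg: "path (h \<circ> g)" "path_image (h \<circ> g) \<subseteq> S1 \<times> S1"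
    using path_compose_in [OF ch(1) _ g(1,2)] ch(2) by blast+
  have hg': "pathfinish (h \<circ> g) = pathstart (h \<circ> g)"
    using g(3) by (simp add: pathfinish_compose pathstart_compose)
  have "homotopic_with_canon (\<lambda>u. pathfinish (u \<circ> (h \<circ> g)) = pathstart (u \<circ> (h \<circ> g)))
      (S1 \<times> S1) (S1 \<times> S1) (h \<circ> f \<circ> h') k"
    using iso unfolding isotopic_def
    by (rule homotopic_with_mono) (use hg' in \<open>simp add: pathfinish_compose pathstart_compose\<close>)
  then have "homotopic_loops (S1 \<times> S1) (h \<circ> f \<circ> h' \<circ> (h \<circ> g)) (k \<circ> (h \<circ> g))"
    unfolding homotopic_loops_def
    by (rule homotopic_with_compose_continuous_right)
       (use hg in \<open>auto simp: path_def path_image_def\<close>)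
  then have "homotopic_loops (S1 \<times> S1) (h \<circ> f \<circ> h' \<circ> (h \<circ> g)) (h \<circ> g')"
    using k by (rule homotopic_loops_trans)
  then have "homotopic_loops B (h' \<circ> (h \<circ> f \<circ> h' \<circ> (h \<circ> g))) (h' \<circ> (h \<circ> g'))"
    using ch' by (rule homotopic_loops_continuous_image)
  then show ?thesis
  proof (rule homotopic_loops_cong)
    fix t :: real assume t: "t \<in> {0..1}"
    then have gt: "g t \<in> B"
      using g(2) path_in_imp_mem by blast
    then have "f (g t) \<in> B"
      using fB by blast
    then show "(h' \<circ> (h \<circ> f \<circ> h' \<circ> (h \<circ> g))) t = (f \<circ> g) t"
      using gt h'h by simp
    show "(h' \<circ> (h \<circ> g')) t = g' t"
      using g' [OF t] h'h by simp
  qed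
qed

text \<open>
  Interior and frontier are taken in the 3-sphere, so a homeomorphism of the 3-sphere that
  preserves \<open>N\<close> preserves both.
\<close>

lemma homeomorphism_preserves_exterior:
  assumes f: "homeomorphic_map (top_of_set S3) (top_of_set S3) f" and N: "N \<subseteq> S3" "f ` N = N"
  shows "continuous_on (exterior N) f" "f ` exterior N \<subseteq> exterior N"
    "f ` boundary_torus N \<subseteq> boundary_torus N"
proof -
  have inj: "inj_on f S3" and S3: "f ` S3 = S3" and cont: "continuous_on S3 f"
    using homeomorphic_imp_injective_map [OF f] homeomorphic_imp_surjective_map [OF f]
      homeomorphic_imp_continuous_map [OF f] by auto
  have "f ` ((top_of_set S3) interior_of N) = (top_of_set S3) interior_of N"
    using homeomorphic_map_interior_of [OF f, of N] N by simp
  moreover have "(top_of_set S3) interior_of N \<subseteq> S3"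
    using interior_of_subset_topspace [of "top_of_set S3" N] by simp
  ultimately have "f ` exterior N = exterior N"
    using inj_on_image_set_diff [OF inj, of S3] S3 by (auto simp: exterior_def)
  then show "f ` exterior N \<subseteq> exterior N"
    by simp
  show "continuous_on (exterior N) f"
    by (rule continuous_on_subset [OF cont]) (auto simp: exterior_def)
  show "f ` boundary_torus N \<subseteq> boundary_torus N"
    using homeomorphic_map_frontier_of [OF f, of N] N by (simp add: boundary_torus_def)
qed

theorem proposition1p1:
  fixes K N :: "(real^4) set"
    and \<nu> :: "complex \<times> complex \<Rightarrow> real^4"
    and \<epsilon> :: "real^4 \<Rightarrow> real"
    and z :: "real^4"
    and f :: "real^4 \<Rightarrow> real^4"
    and h :: "real^4 \<Rightarrow> complex \<times> complex"
    and h' :: "complex \<times> complex \<Rightarrow> real^4"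
  assumes "knot K"
    and "regular_neighborhood K \<nu> N"
    and "normal_orientation K \<epsilon>"
    and "z \<in> exterior N"
    and "homeomorphic_map (top_of_set S3) (top_of_set S3) f"
    and "f ` K = K"
    and "f ` N = N"
    and "f z = z"
    and "homeomorphic_maps (top_of_set (boundary_torus N)) T2 h h'"
    and "isotopic T2 (h \<circ> f \<circ> h') id \<or> isotopic T2 (h \<circ> f \<circ> h') minus_id_T2"
  shows "\<exists>F. (\<forall>a \<in> quandle_paths N z. F (quandle_class N z a) = quandle_class N z (f \<circ> a)) \<and>
             (quandle_automorphism (fundamental_quandle N \<nu> \<epsilon> z) F \<or>
              quandle_antiautomorphism (fundamental_quandle N \<nu> \<epsilon> z) F)"
proof -
  interpret boundary_loop_field N z "meridian \<nu> \<epsilon>"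
    using meridian_loop_field assms(2-4) .
  let ?m = "meridian \<nu> \<epsilon>"
  have FQ: "fundamental_quandle N \<nu> \<epsilon> z = loop_quandle"
    by (simp add: fundamental_quandle_def class_operation_def conjugate_loop_def fun_eq_iff)
  have N: "N \<subseteq> S3"
    using regular_neighborhood_compact(2) assms(2) .
  note f = homeomorphism_preserves_exterior [OF assms(5) N assms(7)] assms(8)
  obtain g where g: "homeomorphic_maps (top_of_set S3) (top_of_set S3) f g"
    using assms(5) by (auto simp: homeomorphic_map_maps)
  then have gf: "g (f x) = x" and fg: "f (g x) = x" if "x \<in> S3" for x
    using that by (auto simp: homeomorphic_maps_def)
  have "g ` N = g ` f ` N"
    by (simp only: assms(7))
  also have "\<dots> = N"
    using gf N by (force simp: image_image)
  finally have "g ` N = N" .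
  moreover have "homeomorphic_map (top_of_set S3) (top_of_set S3) g"
    using g homeomorphic_maps_map by blast
  moreover have ES: "E \<subseteq> S3"
    by (auto simp: exterior_def)
  moreover have "g z = z"
    using gf [OF subsetD [OF ES base_in]] assms(8) by simp
  ultimately have g': "continuous_on E g" "g ` E \<subseteq> E" "g ` B \<subseteq> B" "g z = z"
    using homeomorphism_preserves_exterior [of g N] N by auto
  have bij: "bij_betw (induced_map f) (Q // quandle_path_rel N z) (Q // quandle_path_rel N z)"
    by (rule induced_map_bij [OF f g']) (use gf fg ES in auto)
  then have into: "induced_map f \<in> Q // quandle_path_rel N z \<rightarrow> Q // quandle_path_rel N z"
    by (auto simp: bij_betw_def)
  have operation: "induced_map f (class_operation N z ?m A C) =
      class_operation N z m' (induced_map f A) (induced_map f C)"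
    if "boundary_loop_field N z m'" "\<And>p. p \<in> B \<Longrightarrow> homotopic_loops B (f \<circ> ?m p) (m' p)"
      "A \<in> Q // quandle_path_rel N z" "C \<in> Q // quandle_path_rel N z" for m' A C
    using induced_map_operation [OF f that(1,2)] that(3,4) by (metis carrier_cases)
  have loop: "path (?m p)" "path_image (?m p) \<subseteq> B" "pathfinish (?m p) = pathstart (?m p)" if "p \<in> B" for p
    using that field_image_boundary by auto
  note torus = homotopic_loops_torus_map [OF assms(9) f(3)]
  have hm: "path (h \<circ> ?m p)" "path_image (h \<circ> ?m p) \<subseteq> S1 \<times> S1" 
    "pathfinish (h \<circ> ?m p) = pathstart (h \<circ> ?m p)" if "p \<in> B" for p
  proof -
    have "continuous_on B h" "h \<in> B \<rightarrow> S1 \<times> S1"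
      using assms(9) by (simp_all add: homeomorphic_maps_def)
    then have hB: "continuous_on B h" "h ` B \<subseteq> S1 \<times> S1"
      by blast+
    show "path (h \<circ> ?m p)" "path_image (h \<circ> ?m p) \<subseteq> S1 \<times> S1"
      using path_compose_in [OF hB loop(1,2) [OF that]] .
    show "pathfinish (h \<circ> ?m p) = pathstart (h \<circ> ?m p)"
      using loop(3) [OF that] by (simp add: pathfinish_compose pathstart_compose)
  qed
  have "quandle_automorphism loop_quandle (induced_map f) \<or> quandle_antiautomorphism loop_quandle (induced_map f)"
    using assms(10)
  proof
    assume iso: "isotopic T2 (h \<circ> f \<circ> h') id"
    have "homotopic_loops B (f \<circ> ?m p) (?m p)" if "p \<in> B" for p
    proof (rule torus [OF iso loop [OF that]])
      show "homotopic_loops (S1 \<times> S1) (id \<circ> (h \<circ> ?m p)) (h \<circ> ?m p)"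
        unfolding id_comp homotopic_loops_refl using hm [OF that] by blast
    qed (rule field_in [OF that])
    then show ?thesis
      using operation [OF boundary_loop_field_axioms] bij into quandle_loop_quandle
      by (simp add: quandle_automorphism_def quandle_hom_def)
  next
    assume iso: "isotopic T2 (h \<circ> f \<circ> h') minus_id_T2"
    have "homotopic_loops B (f \<circ> ?m p) (reversepath (?m p))" if "p \<in> B" for p
    proof (rule torus [OF iso loop [OF that]])
      show "homotopic_loops (S1 \<times> S1) (minus_id_T2 \<circ> (h \<circ> ?m p)) (h \<circ> reversepath (?m p))"
        using homotopic_loops_torus_inverse [OF hm [OF that]] by (simp add: path_compose_reversepath)
    qed (use field_in [OF that] in \<open>auto simp: reversepath_def\<close>)
    then show ?thesis
      using operation [OF reverse_field] bij into quandle_loop_quandle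
      by (simp add: quandle_antiautomorphism_def quandle_antihom_def)
  qed
  then show ?thesis
    unfolding FQ using induced_map_class [OF f] by blast
qed

end
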